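(* Let $N\ge3$ and $2^*:=\frac{2N}{N-2}$. Then $$C_{N,2^*}=\tfrac12\,\mathcal S_2,$$ and $C_{N,2^*}$ is not attained, i.e. there is no $u\in X\setminus\{0\}$ with $J(u)=C_{N,2^*}\,\|u\|_{\ell^{2^*}(\mathbb Z^N)}^{2}$.
   Context: $\mathbb Z^N$ is the integer lattice graph: $x\sim y$ iff $\sum_{i=1}^N|x^{(i)}-y^{(i)}|=1$. For $u:\mathbb Z^N\to\mathbb R$ and $x\sim y$ write $\nabla_{xy}u:=u(y)-u(x)$. $\ell^q(\mathbb Z^N)$ is the usual space with norm $\|u\|_{\ell^q}=(\sum_x|u(x)|^q)^{1/q}$. Put $\|u\|_{D^{1,2}(\mathbb Z^N)}:=\big(\frac12\sum_{x\in\mathbb Z^N}\sum_{y\sim x}|\nabla_{xy}u|^2\big)^{1/2}$. $D^{1,2}(\mathbb Z^N)$ is the completion of the finitely supported functions in this norm; by the discrete Sobolev inequality ($\|u\|_{\ell^{q}}\le C\|u\|_{D^{1,2}}$ for $q\ge 2^*$) it is realized as the set of $u\in\ell^{2^*}(\mathbb Z^N)$ for which there are finitely supported $\varphi_k$ with $\|u-\varphi_k\|_{D^{1,2}}\to0$. $X:=\{u\in D^{1,2}(\mathbb Z^N): |\nabla_{xy}u|\le 1 \text{ for every } x\sim y\}$ and, for $u\in X$, $J(u):=\frac12\sum_{x\in\mathbb Z^N}\sum_{y\sim x}\big(1-\sqrt{1-|\nabla_{xy}u|^2}\big)$. For $\alpha>2$, $C_{N,\alpha}:=\inf_{u\in (X\cap\ell^\alpha(\mathbb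 Z^N))\setminus\{0\}} J(u)\big/\big(\sum_{x}|u(x)|^\alpha\big)^{\frac{N}{N+\alpha}}$. For $\alpha=2^*$ the denominator equals $\|u\|_{\ell^{2^*}}^2$, and $X\subset\ell^{2^*}(\mathbb Z^N)$. $\mathcal S_2:=\inf_{u\in D^{1,2}(\mathbb Z^N)\setminus\{0\}}\|u\|_{D^{1,2}(\mathbb Z^N)}^2/\|u\|_{\ell^{2^*}(\mathbb Z^N)}^2$. *)

theory Defs
  imports "HOL-Analysis.Analysis"
begin

text \<open>The lattice is \<^typ>\<open>int ^ 'n\<close>, of dimension \<^term>\<open>CARD('n)\<close>.\<close>

definition lattice_adj :: "int ^ 'n \<Rightarrow> int ^ 'n \<Rightarrow> bool" where
  "lattice_adj x y \<longleftrightarrow> (\<Sum>i\<in>UNIV. \<bar>x $ i - y $ i\<bar>) = 1"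

definition grad :: "(int ^ 'n \<Rightarrow> real) \<Rightarrow> int ^ 'n \<Rightarrow> int ^ 'n \<Rightarrow> real" where
  "grad u x y = u y - u x"

definition ell :: "real \<Rightarrow> (int ^ 'n \<Rightarrow> real) set" where
  "ell q = {u. (\<lambda>x. \<bar>u x\<bar> powr q) summable_on UNIV}"

definition ell_norm :: "real \<Rightarrow> (int ^ 'n \<Rightarrow> real) \<Rightarrow> real" where
  "ell_norm q u = (\<Sum>\<^sub>\<infinity>x. \<bar>u x\<bar> powr q) powr (1 / q)"

text \<open>
  Since \<^const>\<open>infsum\<close> is 0 on families that are not summable, finiteness of the Dirichlet
  energy is a separate predicate, and \<open>D12_norm\<close> is meaningful only when it holds.
\<close>

definition finite_energy :: "(int ^ 'n \<Rightarrow> real) \<Rightarrow> bool" where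
  "finite_energy u \<longleftrightarrow> (\<lambda>x. \<Sum>y | lattice_adj x y. \<bar>grad u x y\<bar>\<^sup>2) summable_on UNIV"

definition D12_norm :: "(int ^ 'n \<Rightarrow> real) \<Rightarrow> real" where
  "D12_norm u = sqrt (1 / 2 * (\<Sum>\<^sub>\<infinity>x. \<Sum>y | lattice_adj x y. \<bar>grad u x y\<bar>\<^sup>2))"

definition crit_exp :: "'n::finite itself \<Rightarrow> real" where
  "crit_exp N = 2 * real CARD('n) / (real CARD('n) - 2)"

definition D12 :: "(int ^ 'n \<Rightarrow> real) set" where
  "D12 = {u \<in> ell (crit_exp TYPE('n)).
     \<exists>\<phi> :: nat \<Rightarrow> int ^ 'n \<Rightarrow> real.
       (\<forall>k. finite {x. \<phi> k x \<noteq> 0}) \<and>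
       (\<forall>k. finite_energy (\<lambda>x. u x - \<phi> k x)) \<and>
       (\<lambda>k. D12_norm (\<lambda>x. u x - \<phi> k x)) \<longlonglongrightarrow> 0}"

definition X_space :: "(int ^ 'n \<Rightarrow> real) set" where
  "X_space = {u \<in> D12. \<forall>x y. lattice_adj x y \<longrightarrow> \<bar>grad u x y\<bar> \<le> 1}"

definition J_fun :: "(int ^ 'n \<Rightarrow> real) \<Rightarrow> real" where
  "J_fun u = 1 / 2 * (\<Sum>\<^sub>\<infinity>x. \<Sum>y | lattice_adj x y. (1 - sqrt (1 - \<bar>grad u x y\<bar>\<^sup>2)))"

text \<open>
  Both infima are taken in the reals; the sets of quotients are bounded below by 0 and
  nonempty (consider the indicator of a single lattice point).
\<close>

definition C_const :: "'n::finite itself \<Rightarrow> real \<Rightarrow> real" where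
  "C_const N \<alpha> =
     (INF u \<in> (X_space \<inter> ell \<alpha>) - {\<lambda>_ :: int ^ 'n. 0}.
        J_fun u / (\<Sum>\<^sub>\<infinity>x. \<bar>u x\<bar> powr \<alpha>) powr (real CARD('n) / (real CARD('n) + \<alpha>)))"

definition S2_const :: "'n::finite itself \<Rightarrow> real" where
  "S2_const N =
     (INF u \<in> D12 - {\<lambda>_ :: int ^ 'n. 0}.
        (D12_norm u)\<^sup>2 / (ell_norm (crit_exp TYPE('n)) u)\<^sup>2)"

text \<open>The inner sums over neighbours are genuine finite sums.\<close>

lemma finite_neighbours: "finite {y. lattice_adj x y}" for x :: "int ^ 'n"
proof (rule finite_subset)
  let ?B = "PiE UNIV (\<lambda>i. {x $ i - 1..x $ i + 1})"
  show "finite (vec_lambda ` ?B)"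
    by (intro finite_imageI finite_PiE) auto
  show "{y. lattice_adj x y} \<subseteq> vec_lambda ` ?B"
  proof
    fix y assume "y \<in> {y. lattice_adj x y}"
    then have s: "(\<Sum>i\<in>UNIV. \<bar>x $ i - y $ i\<bar>) = 1"
      by (simp add: lattice_adj_def)
    have "\<bar>x $ i - y $ i\<bar> \<le> 1" for i
      using member_le_sum[of i UNIV "\<lambda>i. \<bar>x $ i - y $ i\<bar>"] s by simp
    then have "vec_nth y \<in> ?B"
      by (auto simp: abs_le_iff algebra_simps)
    then show "y \<in> vec_lambda ` ?B"
      by (metis image_eqI vec_nth_inverse)
  qed
qed

text \<open>The series defining \<open>J_fun\<close> converges for finite energy and slopes at most 1.\<close>

lemma J_fun_summable:
  fixes u :: "int ^ 'n \<Rightarrow> real"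
  assumes "finite_energy u" and le: "\<And>x y. lattice_adj x y \<Longrightarrow> \<bar>grad u x y\<bar> \<le> 1"
  shows "(\<lambda>x. \<Sum>y | lattice_adj x y. (1 - sqrt (1 - \<bar>grad u x y\<bar>\<^sup>2))) summable_on UNIV"
proof (rule summable_on_comparison_test)
  show "(\<lambda>x. \<Sum>y | lattice_adj x y. \<bar>grad u x y\<bar>\<^sup>2) summable_on UNIV"
    using assms(1) by (simp add: finite_energy_def)
  have sq: "\<bar>grad u x y\<bar>\<^sup>2 \<le> 1" if "lattice_adj x y" for x y
    using le[OF that] by (simp add: abs_square_le_1)
  have up: "1 - sqrt (1 - t) \<le> t" if "0 \<le> t" "t \<le> 1" for t :: real
  proof -
    have "(1 - t)\<^sup>2 \<le> 1 - t"
      using that by (simp add: power2_eq_square mult_left_le)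
    then have "1 - t \<le> sqrt (1 - t)"
      by (rule real_le_rsqrt)
    then show ?thesis by simp
  qed
  show "(\<Sum>y | lattice_adj x y. (1 - sqrt (1 - \<bar>grad u x y\<bar>\<^sup>2)))
      \<le> (\<Sum>y | lattice_adj x y. \<bar>grad u x y\<bar>\<^sup>2)" for x
    using sq by (intro sum_mono up) auto
  show "0 \<le> (\<Sum>y | lattice_adj x y. (1 - sqrt (1 - \<bar>grad u x y\<bar>\<^sup>2)))" for x
    by (intro sum_nonneg) simp
qed

end

theory Submission
  imports Defs
begin

text \<open>
  Since \<open>1 - sqrt (1 - s) > s / 2\<close> for \<open>0 < s \<le> 1\<close>, the functional strictly dominates half of the
  squared Dirichlet norm on nonzero functions of \<open>\<ell>\<^sup>q\<close>, which are never constant. Conversely,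
  \<open>1 - sqrt (1 - s) \<le> s / 2 + s\<^sup>2 / 2\<close> and the boundedness of the slopes of any function of
  \<open>D\<^sup>1\<^sup>,\<^sup>2\<close> show that along \<open>t u\<close> with \<open>t \<rightarrow> 0\<close> the two quotients become comparable, so both infima
  agree. Equality being attained would contradict the strict inequality.
\<close>

section \<open>Scalar bounds on \<open>1 - sqrt (1 - s)\<close>\<close>

lemma sqrt_defect_less:
  fixes s :: real
  assumes "0 < s" "s \<le> 1"
  shows "s / 2 < 1 - sqrt (1 - s)"
proof -
  \<comment> \<open>After squaring, the right side exceeds \<open>1 - s\<close> by
    \<open>s^2 / 4\<close>, positive because \<open>0 < s\<close>.\<close>
  have "sqrt (1 - s) < 1 - s / 2"
    using assms by (intro real_less_lsqrt) (auto simp: power2_eq_square algebra_simps)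
  then show ?thesis by simp
qed

lemma sqrt_defect_ge:
  fixes s :: real
  assumes "0 \<le> s" "s \<le> 1"
  shows "s / 2 \<le> 1 - sqrt (1 - s)"
  using sqrt_defect_less[of s] assms by (cases "s = 0") auto

lemma sqrt_defect_le:
  fixes s :: real
  assumes "0 \<le> s" "s \<le> 1"
  shows "1 - sqrt (1 - s) \<le> s / 2 + s\<^sup>2 / 2"
proof -
  \<comment> \<open>The target \<open>1 - s / 2 - s^2 / 2\<close> factors as
    \<open>(1 - s) * (1 + s / 2)\<close>, so its square keeps a factor \<open>1 - s\<close>, with a
    cofactor of at most 1.\<close>
  have "((1 - s) * (1 + s / 2))\<^sup>2 = (1 - s) * (1 - (3 / 4 * s^2 + s^3 / 4))"
    by (simp add: power2_eq_square power3_eq_cube field_simps)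
  also have "\<dots> \<le> (1 - s) * 1"
    using assms zero_le_power[of s 2] zero_le_power[of s 3] by (intro mult_left_mono) linarith+
  finally have "(1 - s) * (1 + s / 2) \<le> sqrt (1 - s)"
    by (intro real_le_rsqrt) simp
  moreover have "(1 - s) * (1 + s / 2) = 1 - (s / 2 + s\<^sup>2 / 2)"
    by (simp add: power2_eq_square field_simps)
  ultimately show ?thesis by linarith
qed

section \<open>Vertex densities of the two energies\<close>

definition energy_density :: "(int ^ 'n \<Rightarrow> real) \<Rightarrow> int ^ 'n \<Rightarrow> real" where
  "energy_density u x = (\<Sum>y | lattice_adj x y. \<bar>grad u x y\<bar>\<^sup>2)"

definition J_density :: "(int ^ 'n \<Rightarrow> real) \<Rightarrow> int ^ 'n \<Rightarrow> real" where
  "J_density u x = (\<Sum>y | lattice_adj x y. (1 - sqrt (1 - \<bar>grad u x y\<bar>\<^sup>2)))"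

lemma finite_energy_iff: "finite_energy u \<longleftrightarrow> energy_density u summable_on UNIV"
  by (simp add: finite_energy_def energy_density_def[abs_def])

lemma energy_density_nonneg: "0 \<le> energy_density u x"
  unfolding energy_density_def by (intro sum_nonneg) simp

lemma D12_norm_sq: "(D12_norm u)\<^sup>2 = 1 / 2 * (\<Sum>\<^sub>\<infinity>x. energy_density u x)"
proof -
  have "0 \<le> (\<Sum>\<^sub>\<infinity>x. energy_density u x)"
    by (intro infsum_nonneg energy_density_nonneg)
  then show ?thesis
    by (simp add: D12_norm_def energy_density_def[abs_def])
qed

lemma J_fun_eq: "J_fun u = 1 / 2 * (\<Sum>\<^sub>\<infinity>x. J_density u x)"
  by (simp add: J_fun_def J_density_def[abs_def])

lemma lattice_adj_sym: "lattice_adj x y \<longleftrightarrow> lattice_adj y x"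
  by (simp add: lattice_adj_def abs_minus_commute)

section \<open>Behaviour under scalar multiples\<close>

lemma grad_scale: "grad (\<lambda>x. t * u x) x y = t * grad u x y"
  by (simp add: grad_def algebra_simps)

lemma energy_density_scale: "energy_density (\<lambda>x. t * u x) x = t\<^sup>2 * energy_density u x"
  by (simp add: energy_density_def grad_scale abs_mult power_mult_distrib sum_distrib_left)

lemma finite_energy_scale: "finite_energy u \<Longrightarrow> finite_energy (\<lambda>x. t * u x)"
  unfolding finite_energy_iff energy_density_scale[abs_def]
  by (rule summable_on_cmult_right)

lemma D12_norm_scale: "D12_norm (\<lambda>x. t * u x) = \<bar>t\<bar> * D12_norm u"
proof -
  have "D12_norm (\<lambda>x. t * u x) = sqrt (1 / 2 * (\<Sum>\<^sub>\<infinity>x. t\<^sup>2 * energy_density u x))"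
    unfolding D12_norm_def energy_density_def[symmetric] energy_density_scale ..
  \<comment> \<open>This also covers divergent energy, where \<open>infsum\<close> gives 0 on both
    sides.\<close>
  also have "\<dots> = sqrt (t\<^sup>2 * (1 / 2 * (\<Sum>\<^sub>\<infinity>x. energy_density u x)))"
    by (simp add: infsum_cmult_right')
  also have "\<dots> = \<bar>t\<bar> * D12_norm u"
    by (simp only: real_sqrt_mult real_sqrt_abs D12_norm_def energy_density_def)
  finally show ?thesis .
qed

lemma ell_scale:
  assumes "u \<in> ell q"
  shows "(\<lambda>x. t * u x) \<in> ell q"
  using assms by (auto simp: ell_def abs_mult powr_mult intro!: summable_on_cmult_right)

lemma ell_norm_scale: "q \<noteq> 0 \<Longrightarrow> ell_norm q (\<lambda>x. t * u x) = \<bar>t\<bar> * ell_norm q u"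
  by (simp add: ell_norm_def abs_mult powr_mult infsum_cmult_right' infsum_nonneg powr_powr)

lemma D12_scale:
  fixes u :: "int ^ 'n \<Rightarrow> real"
  assumes "u \<in> D12"
  shows "(\<lambda>x. t * u x) \<in> D12"
proof -
  from assms obtain \<phi> where \<phi>: "\<And>k::nat. finite {x. \<phi> k x \<noteq> 0}"
    "\<And>k. finite_energy (\<lambda>x. u x - \<phi> k x)" "(\<lambda>k. D12_norm (\<lambda>x. u x - \<phi> k x)) \<longlonglongrightarrow> 0"
    by (auto simp: D12_def)
  have diff: "(\<lambda>x. t * u x - t * \<phi> k x) = (\<lambda>x. t * (u x - \<phi> k x))" for k
    by (simp add: algebra_simps)
  have "finite {x. t * \<phi> k x \<noteq> 0}" for k
    by (rule finite_subset[OF _ \<phi>(1)[of k]]) auto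
  moreover have "finite_energy (\<lambda>x. t * u x - t * \<phi> k x)" for k
    unfolding diff by (rule finite_energy_scale[OF \<phi>(2)])
  moreover have "(\<lambda>k. D12_norm (\<lambda>x. t * u x - t * \<phi> k x)) \<longlonglongrightarrow> 0"
    unfolding diff D12_norm_scale using tendsto_mult_right_zero[OF \<phi>(3)] .
  moreover have "(\<lambda>x. t * u x) \<in> ell (crit_exp TYPE('n))"
    using assms by (auto simp: D12_def intro: ell_scale)
  ultimately show ?thesis
    unfolding D12_def by (auto intro!: exI[of _ "\<lambda>k x. t * \<phi> k x"])
qed

section \<open>Finite energy and uniform slope bounds\<close>

lemma finite_support_finite_energy:
  fixes \<phi> :: "int ^ 'n \<Rightarrow> real"
  assumes "finite {x. \<phi> x \<noteq> 0}"
  shows "finite_energy \<phi>"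
proof -
  let ?S = "{x. \<phi> x \<noteq> 0}"
  \<comment> \<open>A point off the support still has positive density if a neighbour lies in the
    support, so the neighbours are added.\<close>
  let ?T = "?S \<union> (\<Union>x\<in>?S. {y. lattice_adj x y})"
  have "finite ?T"
    using assms finite_neighbours by auto
  moreover have "energy_density \<phi> x = 0" if "x \<notin> ?T" for x
    using that lattice_adj_sym[of x] by (auto simp: energy_density_def grad_def intro!: sum.neutral)
  ultimately have "energy_density \<phi> summable_on UNIV"
    using summable_on_cong_neutral[of UNIV ?T "energy_density \<phi>" "energy_density \<phi>"] by auto
  then show ?thesis by (simp add: finite_energy_iff)
qed

lemma finite_energy_add:
  fixes u v :: "int ^ 'n \<Rightarrow> real"
  assumes "finite_energy u" "finite_energy v"
  shows "finite_energy (\<lambda>x. u x + v x)"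
  unfolding finite_energy_iff
proof (rule summable_on_comparison_test)
  show "(\<lambda>x. 2 * energy_density u x + 2 * energy_density v x) summable_on UNIV"
    using assms unfolding finite_energy_iff
    by (intro summable_on_add summable_on_cmult_right)
  have *: "\<bar>grad (\<lambda>x. u x + v x) x y\<bar>\<^sup>2 \<le> 2 * \<bar>grad u x y\<bar>\<^sup>2 + 2 * \<bar>grad v x y\<bar>\<^sup>2" for x y
    using sum_squares_bound[of "grad u x y" "grad v x y"]
    by (simp add: grad_def power2_eq_square algebra_simps)
  show "energy_density (\<lambda>x. u x + v x) x \<le> 2 * energy_density u x + 2 * energy_density v x" for x
    unfolding energy_density_def sum_distrib_left sum.distrib[symmetric] by (intro sum_mono *)
qed (rule energy_density_nonneg)

text \<open>One approximant suffices: \<open>u\<close> is the sum of \<open>u - \<phi>\<close> and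
  the finitely supported \<open>\<phi>\<close>, both of finite energy.\<close>

lemma D12_finite_energy:
  assumes "u \<in> D12"
  shows "finite_energy u"
proof -
  from assms obtain \<phi> where "finite {x. \<phi> x \<noteq> 0}" "finite_energy (\<lambda>x. u x - \<phi> x)"
    by (auto simp: D12_def)
  then show ?thesis
    using finite_energy_add[of "\<lambda>x. u x - \<phi> x" \<phi>] finite_support_finite_energy[of \<phi>] by simp
qed

lemma grad_sq_le_energy_density:
  "lattice_adj x y \<Longrightarrow> (grad u x y)\<^sup>2 \<le> energy_density u x"
  unfolding energy_density_def
  using member_le_sum[of y "{y. lattice_adj x y}" "\<lambda>y. \<bar>grad u x y\<bar>\<^sup>2"] finite_neighbours[of x]
  by simp

lemma nonneg_le_infsum:
  fixes f :: "'a \<Rightarrow> real"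
  assumes "f summable_on UNIV" "\<And>x. 0 \<le> f x"
  shows "f x \<le> (\<Sum>\<^sub>\<infinity>x. f x)"
  using finite_sum_le_infsum[of f UNIV "{x}"] assms by simp

text \<open>A single term is at most the whole nonnegative series; the 2 undoes the factor 1/2 in
  \<open>D12_norm\<close>. Since the bound is uniform over edges, small multiples of
  \<open>u\<close> have slopes at most 1.\<close>

lemma grad_sq_le_energy:
  assumes "finite_energy u" "lattice_adj x y"
  shows "(grad u x y)\<^sup>2 \<le> 2 * (D12_norm u)\<^sup>2"
  using grad_sq_le_energy_density[OF assms(2), of u]
    nonneg_le_infsum[of "energy_density u" x] assms(1) energy_density_nonneg[of u]
  by (simp add: D12_norm_sq finite_energy_iff)

section \<open>Comparison of \<open>J_fun\<close> with the Dirichlet norm\<close>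

lemma X_slope_sq:
  assumes "u \<in> X_space" "lattice_adj x y"
  shows "\<bar>grad u x y\<bar>\<^sup>2 \<le> 1"
  using assms by (auto simp: X_space_def abs_square_le_1)

lemma X_J_density_summable:
  assumes "u \<in> X_space"
  shows "J_density u summable_on UNIV"
  using assms J_fun_summable[of u] D12_finite_energy[of u]
  by (auto simp: J_density_def[abs_def] X_space_def)

text \<open>A nonzero value would repeat at infinitely many points of a coordinate ray,
  contradicting summability. This yields an edge with nonzero slope for every nonzero function of
  the space.\<close>

lemma ell_constant_along_edges_eq_0:
  fixes u :: "int ^ 'n \<Rightarrow> real"
  assumes "u \<in> ell q" and const: "\<And>x y. lattice_adj x y \<Longrightarrow> u y = u x"
  shows "u = (\<lambda>_. 0)"
proof (rule ccontr)
  assume "u \<noteq> (\<lambda>_. 0)"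
  then obtain x where x: "u x \<noteq> 0" by blast
  \<comment> \<open>The ray from \<open>x\<close> in one fixed coordinate direction;
    \<open>undefined\<close> merely picks an index.\<close>
  define p :: "nat \<Rightarrow> int ^ 'n" where "p = (\<lambda>k. x + axis undefined (int k))"
  have "p k $ i - p (Suc k) $ i = (if i = undefined then -1 else 0)" for k i
    by (simp add: p_def axis_def)
  then have adj: "lattice_adj (p k) (p (Suc k))" for k
    by (simp add: lattice_adj_def if_distrib[of abs] cong: if_cong)
  have up: "u (p k) = u x" for k
  proof (induction k)
    case 0
    have "p 0 = x" by (simp add: p_def axis_def vec_eq_iff)
    then show ?case by simp
  next
    case (Suc k)
    then show ?case using const[OF adj[of k]] by simp
  qed
  have inj: "inj p"
    by (auto simp: inj_def p_def axis_eq_axis)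
  let ?f = "\<lambda>y. \<bar>u y\<bar> powr q"
  \<comment> \<open>The first \<open>k\<close> points of the ray are distinct and contribute
    \<open>?f x\<close> each, so the finite sum would bound all multiples of a positive
    number.\<close>
  have "real k * ?f x \<le> (\<Sum>\<^sub>\<infinity>y. ?f y)" for k
  proof -
    have "real k * ?f x = sum ?f (p ` {..<k})"
      using inj by (simp add: sum.reindex inj_on_def up inj_def)
    also have "\<dots> \<le> (\<Sum>\<^sub>\<infinity>y. ?f y)"
      using assms(1) by (intro finite_sum_le_infsum) (auto simp: ell_def)
    finally show ?thesis .
  qed
  moreover have "0 < ?f x" using x by simp
  ultimately show False
    using ex_less_of_nat_mult[of "?f x" "\<Sum>\<^sub>\<infinity>y. ?f y"] by (auto simp: not_le[symmetric])
qed

lemma energy_density_le_J_density: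
  assumes "u \<in> X_space"
  shows "1 / 2 * energy_density u x \<le> J_density u x"
  unfolding energy_density_def J_density_def sum_distrib_left
proof (rule sum_mono)
  fix y assume "y \<in> {y. lattice_adj x y}"
  then show "1 / 2 * \<bar>grad u x y\<bar>\<^sup>2 \<le> 1 - sqrt (1 - \<bar>grad u x y\<bar>\<^sup>2)"
    using sqrt_defect_ge[of "\<bar>grad u x y\<bar>\<^sup>2"] X_slope_sq[OF assms, of x y] by simp
qed

text \<open>The densities compare weakly at every vertex and strictly at an endpoint of an edge with
  nonzero slope; one strict term makes the inequality of the convergent series strict.\<close>

lemma half_D12_norm_sq_less_J:
  fixes u :: "int ^ 'n \<Rightarrow> real"
  assumes X: "u \<in> X_space" and nz: "u \<noteq> (\<lambda>_. 0)"
  shows "1 / 2 * (D12_norm u)\<^sup>2 < J_fun u"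
proof -
  have "u \<in> D12" using X by (simp add: X_space_def)
  then have en: "energy_density u summable_on UNIV" and l: "u \<in> ell (crit_exp TYPE('n))"
    using D12_finite_energy by (auto simp: finite_energy_iff D12_def)
  obtain a b where ab: "lattice_adj a b" "u b \<noteq> u a"
    using ell_constant_along_edges_eq_0[OF l] nz by blast
  have "1 / 2 * energy_density u a < J_density u a"
    unfolding energy_density_def J_density_def sum_distrib_left
  proof (rule sum_strict_mono_ex1)
    show "\<forall>y\<in>{y. lattice_adj a y}. 1 / 2 * \<bar>grad u a y\<bar>\<^sup>2 \<le> 1 - sqrt (1 - \<bar>grad u a y\<bar>\<^sup>2)"
      using sqrt_defect_ge X_slope_sq[OF X] by auto
    show "\<exists>y\<in>{y. lattice_adj a y}. 1 / 2 * \<bar>grad u a y\<bar>\<^sup>2 < 1 - sqrt (1 - \<bar>grad u a y\<bar>\<^sup>2)"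
      using sqrt_defect_less[of "\<bar>grad u a b\<bar>\<^sup>2"] X_slope_sq[OF X ab(1)] ab
      by (auto simp: grad_def intro!: bexI[of _ b])
  qed (rule finite_neighbours)
  then have less: "(\<Sum>\<^sub>\<infinity>x. 1 / 2 * energy_density u x) < (\<Sum>\<^sub>\<infinity>x. J_density u x)"
    using energy_density_le_J_density[OF X] en X_J_density_summable[OF X]
    by (intro has_sum_strict_mono[OF has_sum_infsum has_sum_infsum, where x = a]
        summable_on_cmult_right) auto
  show ?thesis
    using less[unfolded infsum_cmult_right'] by (simp add: D12_norm_sq J_fun_eq)
qed

text \<open>With squared slopes \<open>s \<le> m\<close>, the error \<open>s^2 / 2\<close> is at
  most \<open>m * s / 2\<close>, hence a relative error \<open>m\<close> that vanishes as the slopes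
  shrink.\<close>

lemma J_le_D12_norm_sq:
  assumes X: "u \<in> X_space" and m: "\<And>x y. lattice_adj x y \<Longrightarrow> (grad u x y)\<^sup>2 \<le> m"
  shows "J_fun u \<le> 1 / 2 * (1 + m) * (D12_norm u)\<^sup>2"
proof -
  have "J_density u x \<le> (1 + m) / 2 * energy_density u x" for x
    unfolding energy_density_def J_density_def sum_distrib_left
  proof (rule sum_mono)
    fix y assume "y \<in> {y. lattice_adj x y}"
    then have y: "lattice_adj x y" by simp
    define s where "s = \<bar>grad u x y\<bar>\<^sup>2"
    have s: "0 \<le> s" "s \<le> 1" "s \<le> m"
      using X_slope_sq[OF X y] m[OF y] by (auto simp: s_def)
    have "1 - sqrt (1 - s) \<le> s / 2 + s\<^sup>2 / 2" by (rule sqrt_defect_le[OF s(1,2)])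
    also have "\<dots> \<le> (1 + m) / 2 * s"
      using mult_right_mono[OF s(3,1)] by (simp add: power2_eq_square field_simps)
    finally show "1 - sqrt (1 - \<bar>grad u x y\<bar>\<^sup>2) \<le> (1 + m) / 2 * \<bar>grad u x y\<bar>\<^sup>2"
      unfolding s_def .
  qed
  moreover have "energy_density u summable_on UNIV"
    using X D12_finite_energy by (auto simp: X_space_def finite_energy_iff)
  ultimately have le: "(\<Sum>\<^sub>\<infinity>x. J_density u x) \<le> (\<Sum>\<^sub>\<infinity>x. (1 + m) / 2 * energy_density u x)"
    using X_J_density_summable[OF X] by (intro infsum_mono summable_on_cmult_right) auto
  show ?thesis
    using le[unfolded infsum_cmult_right'] by (simp add: D12_norm_sq J_fun_eq)
qed

section \<open>The quotients and their infima\<close>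

lemma ell_norm_pos:
  assumes "u \<in> ell q" "u \<noteq> (\<lambda>_. 0)"
  shows "0 < ell_norm q u"
proof -
  obtain x where "u x \<noteq> 0" using assms(2) by blast
  then have "0 < \<bar>u x\<bar> powr q" by simp
  also have "\<dots> \<le> (\<Sum>\<^sub>\<infinity>x. \<bar>u x\<bar> powr q)"
    using assms(1) by (intro nonneg_le_infsum) (auto simp: ell_def)
  finally show ?thesis by (simp add: ell_norm_def)
qed

text \<open>A real infimum is bounded below through \<open>cINF_greatest\<close> only over a
  nonempty set; this serves both constants, as \<open>X_space\<close> lies in
  \<open>D12\<close>.\<close>

lemma X_space_nonzero: "X_space - {\<lambda>_ :: int ^ 'n. 0} \<noteq> {}"
proof -
  define u :: "int ^ 'n \<Rightarrow> real" where "u = (\<lambda>x. if x = 0 then 1 else 0)"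
  let ?q = "crit_exp TYPE('n)"
  have "(\<lambda>x. \<bar>u x\<bar> powr ?q) summable_on UNIV"
    using summable_on_cong_neutral[of UNIV "{0}" "\<lambda>x. \<bar>u x\<bar> powr ?q" "\<lambda>x. \<bar>u x\<bar> powr ?q"]
    by (auto simp: u_def)
  moreover have "finite {x. u x \<noteq> 0}" by (simp add: u_def)
  \<comment> \<open>The indicator \<open>u\<close> is its own constant approximating sequence, so
    the differences required by \<open>D12\<close> are the zero function.\<close>
  moreover have "finite_energy (\<lambda>_ :: int ^ 'n. 0)"
    by (rule finite_support_finite_energy) simp
  moreover have "D12_norm (\<lambda>_ :: int ^ 'n. 0) = 0"
    by (simp add: D12_norm_def grad_def)
  ultimately have "u \<in> D12"
    by (auto simp: D12_def ell_def intro!: exI[of _ "\<lambda>_. u"])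
  moreover have "\<bar>grad u x y\<bar> \<le> 1" for x y
    by (simp add: grad_def u_def)
  moreover have "u 0 \<noteq> 0" by (simp add: u_def)
  ultimately show ?thesis by (auto simp: X_space_def)
qed

text \<open>For \<open>\<alpha> = 2\<^sup>*\<close> the exponent \<open>N / (N + \<alpha>)\<close> equals \<open>2 / \<alpha>\<close>.\<close>

lemma C_const_crit:
  assumes "CARD('n::finite) \<ge> 3"
  shows "C_const TYPE('n) (crit_exp TYPE('n)) =
    (INF u \<in> X_space - {\<lambda>_ :: int ^ 'n. 0}. J_fun u / (ell_norm (crit_exp TYPE('n)) u)\<^sup>2)"
proof -
  let ?q = "crit_exp TYPE('n)"
  let ?N = "real CARD('n)"
  have N: "?N \<ge> 3" using assms by simp
  then have "?N + ?q = ?N\<^sup>2 / (?N - 2)" "?q \<noteq> 0"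
    by (auto simp: crit_exp_def field_simps power2_eq_square)
  \<comment> \<open>Splitting the exponent into two equal summands lets \<open>powr_add\<close>
    produce the square as a product.\<close>
  then have e: "?N / (?N + ?q) = 1 / ?q + 1 / ?q"
    using N by (simp add: crit_exp_def field_simps power2_eq_square)
  have "(ell_norm ?q u)\<^sup>2 = (\<Sum>\<^sub>\<infinity>x. \<bar>u x\<bar> powr ?q) powr (?N / (?N + ?q))"
    for u :: "int ^ 'n \<Rightarrow> real"
    unfolding ell_norm_def power2_eq_square e powr_add ..
  moreover have "X_space \<inter> ell ?q = (X_space :: (int ^ 'n \<Rightarrow> real) set)"
    by (auto simp: X_space_def D12_def)
  ultimately show ?thesis by (simp add: C_const_def)
qed

text \<open>Strictness for each single \<open>u\<close> survives in the infimum only as a weak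
  bound, but it is what excludes a minimizer.\<close>

lemma half_quotient_less:
  fixes u :: "int ^ 'n \<Rightarrow> real"
  assumes "u \<in> X_space - {\<lambda>_. 0}"
  shows "1 / 2 * S2_const TYPE('n) < J_fun u / (ell_norm (crit_exp TYPE('n)) u)\<^sup>2"
proof -
  let ?n = "(ell_norm (crit_exp TYPE('n)) u)\<^sup>2"
  have u: "u \<in> D12 - {\<lambda>_. 0}" using assms by (simp add: X_space_def)
  have "S2_const TYPE('n) \<le> (D12_norm u)\<^sup>2 / ?n"
    unfolding S2_const_def by (rule cINF_lower[OF _ u]) (auto intro!: bdd_belowI[of _ 0])
  moreover have "1 / 2 * (D12_norm u)\<^sup>2 / ?n < J_fun u / ?n"
    using half_D12_norm_sq_less_J[of u] assms ell_norm_pos[of u "crit_exp TYPE('n)"] u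
    by (intro divide_strict_right_mono) (auto simp: D12_def)
  moreover have "1 / 2 * (D12_norm u)\<^sup>2 / ?n = 1 / 2 * ((D12_norm u)\<^sup>2 / ?n)"
    by simp
  ultimately show ?thesis by linarith
qed

text \<open>The Dirichlet quotient is invariant under \<open>u \<mapsto> t u\<close>, while the
  \<open>J_fun\<close> quotient of \<open>t u\<close> exceeds half of it by at most the factor
  \<open>1 + t^2 * M\<close>. Small \<open>t\<close> also puts \<open>t u\<close> into
  \<open>X_space\<close>.\<close>

lemma C_const_crit_le:
  fixes u :: "int ^ 'n \<Rightarrow> real"
  assumes N: "CARD('n::finite) \<ge> 3" and u: "u \<in> D12 - {\<lambda>_. 0}"
  shows "C_const TYPE('n) (crit_exp TYPE('n)) \<le>
    1 / 2 * ((D12_norm u)\<^sup>2 / (ell_norm (crit_exp TYPE('n)) u)\<^sup>2)"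
proof -
  let ?q = "crit_exp TYPE('n)"
  let ?C = "C_const TYPE('n) ?q"
  define Q where "Q = (D12_norm u)\<^sup>2 / (ell_norm ?q u)\<^sup>2"
  \<comment> \<open>The uniform bound on squared slopes of \<open>u\<close>; thus
    \<open>t^2 * M\<close> bounds those of \<open>t u\<close> and is used both for membership in
    \<open>X_space\<close> and as \<open>m\<close> in \<open>J_le_D12_norm_sq\<close>.\<close>
  define M where "M = 2 * (D12_norm u)\<^sup>2"
  have q: "?q \<noteq> 0" using N by (simp add: crit_exp_def)
  have fe: "finite_energy u" using u D12_finite_energy by blast
  have bound: "?C \<le> 1 / 2 * (1 + t\<^sup>2 * M) * Q" if t: "0 < t" "t\<^sup>2 * M \<le> 1" for t
  proof -
    let ?v = "\<lambda>x. t * u x"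
    have g: "(grad ?v x y)\<^sup>2 \<le> t\<^sup>2 * M" if "lattice_adj x y" for x y
      using grad_sq_le_energy[OF fe that] unfolding M_def grad_scale power_mult_distrib
      by (rule mult_left_mono) simp
    have "\<bar>grad ?v x y\<bar> \<le> 1" if "lattice_adj x y" for x y
      using order_trans[OF g[OF that] t(2)] by (simp add: abs_square_le_1)
    then have v: "?v \<in> X_space" using u D12_scale[of u t] by (auto simp: X_space_def)
    have nz: "?v \<noteq> (\<lambda>_. 0)" using u t by (auto simp: fun_eq_iff)
    have "?C \<le> J_fun ?v / (ell_norm ?q ?v)\<^sup>2"
      unfolding C_const_crit[OF N]
    proof (rule cINF_lower)
      show "bdd_below ((\<lambda>u :: int ^ 'n \<Rightarrow> real. J_fun u / (ell_norm ?q u)\<^sup>2) `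
          (X_space - {\<lambda>_. 0}))"
        using half_quotient_less by (intro bdd_belowI2 less_imp_le)
    qed (use v nz in simp)
    also have "\<dots> \<le> (1 / 2 * (1 + t\<^sup>2 * M) * (D12_norm ?v)\<^sup>2) / (ell_norm ?q ?v)\<^sup>2"
      by (intro divide_right_mono J_le_D12_norm_sq[OF v g]) auto
    \<comment> \<open>Numerator and denominator both scale by \<open>t^2\<close>, which cancels
      since \<open>0 < t\<close>.\<close>
    also have "\<dots> = 1 / 2 * (1 + t\<^sup>2 * M) * Q"
      using t by (simp add: D12_norm_scale ell_norm_scale[OF q] Q_def power_mult_distrib)
    finally show ?thesis .
  qed
  \<comment> \<open>Letting \<open>t\<close> tend to 0 from the right removes the correction factor;
    \<open>t^2 * M \<le> 1\<close> holds eventually because \<open>t^2 * M\<close> tends to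
    0.\<close>
  have "((\<lambda>t. 1 / 2 * (1 + t\<^sup>2 * M) * Q) \<longlongrightarrow> 1 / 2 * (1 + 0\<^sup>2 * M) * Q) (at_right 0)"
    by (intro tendsto_intros)
  moreover have "((\<lambda>t. t\<^sup>2 * M) \<longlongrightarrow> 0\<^sup>2 * M) (at_right (0::real))"
    by (intro tendsto_intros)
  then have "eventually (\<lambda>t. t\<^sup>2 * M < 1) (at_right (0::real))"
    by (rule order_tendstoD(2)) simp
  then have "eventually (\<lambda>t. ?C \<le> 1 / 2 * (1 + t\<^sup>2 * M) * Q) (at_right 0)"
    using eventually_at_right_less[of 0] by eventually_elim (rule bound; simp)
  ultimately have "?C \<le> 1 / 2 * (1 + 0\<^sup>2 * M) * Q"
    by (intro tendsto_lowerbound) auto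
  then show ?thesis by (simp add: Q_def)
qed

theorem theorem1p2:
  assumes "CARD('n::finite) \<ge> 3"
  shows "C_const TYPE('n) (crit_exp TYPE('n)) = 1 / 2 * S2_const TYPE('n) \<and>
    \<not> (\<exists>u \<in> X_space - {\<lambda>_ :: int ^ 'n. 0}.
         J_fun u = C_const TYPE('n) (crit_exp TYPE('n)) * (ell_norm (crit_exp TYPE('n)) u)\<^sup>2)"
proof -
  let ?q = "crit_exp TYPE('n)"
  let ?C = "C_const TYPE('n) ?q"
  have ne: "D12 - {\<lambda>_ :: int ^ 'n. 0} \<noteq> {}"
    using X_space_nonzero by (auto simp: X_space_def)
  have "1 / 2 * S2_const TYPE('n) \<le> ?C"
    unfolding C_const_crit[OF assms]
    by (intro cINF_greatest X_space_nonzero less_imp_le half_quotient_less)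
  moreover have "2 * ?C \<le> S2_const TYPE('n)"
    unfolding S2_const_def
  proof (rule cINF_greatest[OF ne])
    show "2 * ?C \<le> (D12_norm u)\<^sup>2 / (ell_norm ?q u)\<^sup>2" if "u \<in> D12 - {\<lambda>_. 0}"
      for u :: "int ^ 'n \<Rightarrow> real"
      using C_const_crit_le[OF assms that] by linarith
  qed
  ultimately have C: "?C = 1 / 2 * S2_const TYPE('n)" by simp
  moreover have "J_fun u \<noteq> ?C * (ell_norm ?q u)\<^sup>2" if u: "u \<in> X_space - {\<lambda>_ :: int ^ 'n. 0}" for u
  proof -
    \<comment> \<open>Positivity allows division by the squared norm: attainment would make the
      quotient equal to half of \<open>S2_const\<close>, against
      \<open>half_quotient_less\<close>.\<close>
    have "0 < ell_norm ?q u"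
      using u by (intro ell_norm_pos) (auto simp: X_space_def D12_def)
    then show ?thesis
      using half_quotient_less[OF u] by (auto simp: C)
  qed
  ultimately show ?thesis by blast
qed

end
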